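(* Let $(X,T)$ be a Deaconu-Renault system. Assume that there exists a compact open set $U\subsetneq X$ such that $T(U)=X$ and $T|_U$ is injective (and hence $X$ is compact and $T$ is proper). Then there is no automorphism $\Phi\colon G(X,T)\to G(X,T)$ such that $\sigma_X\circ\Phi=(-\mathrm{id}_{\mathbb{Z}})\circ\sigma_X$.
   Context: $\mathbb{N}=\{0,1,2,\dots\}$. A Deaconu-Renault system $(X,T)$ consists of a locally compact Hausdorff space $X$ and a local homeomorphism $T\colon X\to X$. Its groupoid is $$G(X,T)=\{(y,n-m,x)\in X\times\mathbb{Z}\times X: n,m\in\mathbb{N},\ T^ny=T^mx\},$$ with unit space $\{(x,0,x)\}$ identified with $X$, $d(y,n,x)=x$, $r(y,n,x)=y$, $(z,n,y)(y,m,x)=(z,n+m,x)$, $(y,m,x)^{-1}=(x,-m,y)$, and the topology generated by the sets $Z(U,n,m,V)=\{(y,n-m,x)\in G(X,T): y\in U, x\in V, T^ny=T^mx\}$ for $U,V\subset X$ open and $n,m\in\mathbb{N}$; it is a locally compact Hausdorff étale groupoid. The canonical continuous cocycle is $\sigma_X\colon G(X,T)\to\mathbb{Z}$, $\sigma_X(y,n,x)=n$. Automorphisms of $G(X,T)$ are groupoid automorphisms that are homeomorphisms. *)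

theory Defs
  imports "HOL-Analysis.Analysis"
begin

definition local_homeomorphism :: "'a topology \<Rightarrow> 'b topology \<Rightarrow> ('a \<Rightarrow> 'b) \<Rightarrow> bool"
  where "local_homeomorphism X Y f \<longleftrightarrow>
    f \<in> topspace X \<rightarrow> topspace Y \<and>
    (\<forall>x \<in> topspace X. \<exists>U. openin X U \<and> x \<in> U \<and> openin Y (f ` U) \<and>
        homeomorphic_map (subtopology X U) (subtopology Y (f ` U)) f)"

definition Deaconu_Renault_system :: "'a topology \<Rightarrow> ('a \<Rightarrow> 'a) \<Rightarrow> bool"
  where "Deaconu_Renault_system X T \<longleftrightarrow>
    locally_compact_space X \<and> Hausdorff_space X \<and> local_homeomorphism X X T"


text \<open>
  The arrows carry type \<open>'g\<close> and the units type \<open>'u\<close>; \<open>unit_arrow\<close> identifies the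
  unit space with a set of arrows. The product \<open>gmult G g h\<close> is meaningful only when
  \<open>gdom G g = grng G h\<close>.
\<close>

record ('g, 'u) groupoid_data =
  arrows :: "'g set"
  units :: "'u set"
  gdom :: "'g \<Rightarrow> 'u"
  grng :: "'g \<Rightarrow> 'u"
  unit_arrow :: "'u \<Rightarrow> 'g"
  gmult :: "'g \<Rightarrow> 'g \<Rightarrow> 'g"
  ginv :: "'g \<Rightarrow> 'g"

definition composable :: "('g, 'u) groupoid_data \<Rightarrow> 'g \<Rightarrow> 'g \<Rightarrow> bool"
  where "composable G g h \<longleftrightarrow> g \<in> arrows G \<and> h \<in> arrows G \<and> gdom G g = grng G h"

definition is_groupoid :: "('g, 'u) groupoid_data \<Rightarrow> bool"
  where "is_groupoid G \<longleftrightarrow>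
    (\<forall>g \<in> arrows G. gdom G g \<in> units G \<and> grng G g \<in> units G) \<and>
    (\<forall>u \<in> units G. unit_arrow G u \<in> arrows G \<and>
        gdom G (unit_arrow G u) = u \<and> grng G (unit_arrow G u) = u) \<and>
    (\<forall>g h. composable G g h \<longrightarrow> gmult G g h \<in> arrows G \<and>
        gdom G (gmult G g h) = gdom G h \<and> grng G (gmult G g h) = grng G g) \<and>
    (\<forall>g h k. composable G g h \<and> composable G h k \<longrightarrow>
        gmult G (gmult G g h) k = gmult G g (gmult G h k)) \<and>
    (\<forall>g \<in> arrows G. gmult G g (unit_arrow G (gdom G g)) = g \<and>
        gmult G (unit_arrow G (grng G g)) g = g) \<and>
    (\<forall>g \<in> arrows G. ginv G g \<in> arrows G \<and>
        gdom G (ginv G g) = grng G g \<and> grng G (ginv G g) = gdom G g \<and>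
        gmult G (ginv G g) g = unit_arrow G (gdom G g) \<and>
        gmult G g (ginv G g) = unit_arrow G (grng G g))"

definition groupoid_hom ::
    "('g, 'u) groupoid_data \<Rightarrow> ('h, 'v) groupoid_data \<Rightarrow> ('g \<Rightarrow> 'h) \<Rightarrow> bool"
  where "groupoid_hom G H \<Phi> \<longleftrightarrow>
    \<Phi> \<in> arrows G \<rightarrow> arrows H \<and>
    (\<forall>g h. composable G g h \<longrightarrow>
        composable H (\<Phi> g) (\<Phi> h) \<and> \<Phi> (gmult G g h) = gmult H (\<Phi> g) (\<Phi> h))"

definition groupoid_automorphism :: "('g, 'u) groupoid_data \<Rightarrow> ('g \<Rightarrow> 'g) \<Rightarrow> bool"
  where "groupoid_automorphism G \<Phi> \<longleftrightarrow>
    bij_betw \<Phi> (arrows G) (arrows G) \<and> groupoid_hom G G \<Phi> \<and>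
    groupoid_hom G G (inv_into (arrows G) \<Phi>)"


definition DR_arrows :: "'a topology \<Rightarrow> ('a \<Rightarrow> 'a) \<Rightarrow> ('a \<times> int \<times> 'a) set"
  where "DR_arrows X T =
    {(y, int n - int m, x) | y n m x.
        y \<in> topspace X \<and> x \<in> topspace X \<and> (T ^^ n) y = (T ^^ m) x}"

definition DR_groupoid :: "'a topology \<Rightarrow> ('a \<Rightarrow> 'a) \<Rightarrow> ('a \<times> int \<times> 'a, 'a) groupoid_data"
  where "DR_groupoid X T = \<lparr>
    arrows = DR_arrows X T,
    units = topspace X,
    gdom = (\<lambda>(y, n, x). x),
    grng = (\<lambda>(y, n, x). y),
    unit_arrow = (\<lambda>x. (x, 0, x)),
    gmult = (\<lambda>(z, n, y) (y', m, x). (z, n + m, x)),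
    ginv = (\<lambda>(y, m, x). (x, - m, y)) \<rparr>"

definition DR_basic ::
    "'a topology \<Rightarrow> ('a \<Rightarrow> 'a) \<Rightarrow> 'a set \<Rightarrow> nat \<Rightarrow> nat \<Rightarrow> 'a set \<Rightarrow> ('a \<times> int \<times> 'a) set"
  where "DR_basic X T U n m V =
    {(y, int n - int m, x) | y x.
        (y, int n - int m, x) \<in> DR_arrows X T \<and> y \<in> U \<and> x \<in> V \<and> (T ^^ n) y = (T ^^ m) x}"

definition DR_topology :: "'a topology \<Rightarrow> ('a \<Rightarrow> 'a) \<Rightarrow> ('a \<times> int \<times> 'a) topology"
  where "DR_topology X T =
    topology_generated_by {DR_basic X T U n m V | U n m V. openin X U \<and> openin X V}"

definition DR_cocycle :: "'a \<times> int \<times> 'a \<Rightarrow> int"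
  where "DR_cocycle = (\<lambda>(y, n, x). n)"

definition DR_automorphism ::
    "'a topology \<Rightarrow> ('a \<Rightarrow> 'a) \<Rightarrow> ('a \<times> int \<times> 'a \<Rightarrow> 'a \<times> int \<times> 'a) \<Rightarrow> bool"
  where "DR_automorphism X T \<Phi> \<longleftrightarrow>
    groupoid_automorphism (DR_groupoid X T) \<Phi> \<and>
    homeomorphic_map (DR_topology X T) (DR_topology X T) \<Phi>"

lemma topspace_DR_topology: "topspace (DR_topology X T) = DR_arrows X T"
proof
  show "topspace (DR_topology X T) \<subseteq> DR_arrows X T"
    by (auto simp: DR_topology_def DR_basic_def)
  show "DR_arrows X T \<subseteq> topspace (DR_topology X T)"
  proof
    fix g assume g: "g \<in> DR_arrows X T"
    then obtain y n m x where "g = (y, int n - int m, x)" "y \<in> topspace X" "x \<in> topspace X"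
      "(T ^^ n) y = (T ^^ m) x"
      by (auto simp: DR_arrows_def)
    with g have "g \<in> DR_basic X T (topspace X) n m (topspace X)"
      by (auto simp: DR_basic_def)
    then show "g \<in> topspace (DR_topology X T)"
      unfolding DR_topology_def topology_generated_by_topspace by blast
  qed
qed

lemma DR_arrows_comp:
  assumes "(z, a, y) \<in> DR_arrows X T" "(y, b, x) \<in> DR_arrows X T"
  shows "(z, a + b, x) \<in> DR_arrows X T"
proof -
  obtain n m where 1: "a = int n - int m" "z \<in> topspace X" "(T ^^ n) z = (T ^^ m) y"
    using assms(1) by (auto simp: DR_arrows_def)
  obtain k l where 2: "b = int k - int l" "x \<in> topspace X" "(T ^^ k) y = (T ^^ l) x"
    using assms(2) by (auto simp: DR_arrows_def)
  have "(T ^^ (k + n)) z = (T ^^ (k + m)) y"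
    using 1(3) by (simp add: funpow_add)
  also have "\<dots> = (T ^^ (m + l)) x"
    using 2(3) by (simp add: funpow_add add.commute[of k m])
  finally have "(T ^^ (k + n)) z = (T ^^ (m + l)) x" .
  moreover have "a + b = int (k + n) - int (m + l)"
    using 1(1) 2(1) by simp
  ultimately show ?thesis
    using 1(2) 2(2) unfolding DR_arrows_def by blast
qed

lemma DR_arrows_inv: "(y, a, x) \<in> DR_arrows X T \<Longrightarrow> (x, - a, y) \<in> DR_arrows X T"
  unfolding DR_arrows_def mem_Collect_eq prod.inject by (metis minus_diff_eq)

lemma DR_arrows_unit: "x \<in> topspace X \<Longrightarrow> (x, 0, x) \<in> DR_arrows X T"
  unfolding DR_arrows_def mem_Collect_eq by (metis diff_self)

lemma is_groupoid_DR_groupoid: "is_groupoid (DR_groupoid X T)"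
proof -
  have "y \<in> topspace X \<and> x \<in> topspace X" if "(y, a, x) \<in> DR_arrows X T" for y a x
    using that by (auto simp: DR_arrows_def)
  then show ?thesis
    unfolding is_groupoid_def composable_def DR_groupoid_def
    by (auto intro: DR_arrows_comp DR_arrows_inv DR_arrows_unit)
qed

end

(* If T is injective on U with T ` U = X, the inverse s of T restricted to U gives the compact open
   bisection of arrows (s x, 1, x).  An automorphism that negates the cocycle sends these arrows to
   arrows (p (s x), -1, p x), where p is the bijection induced on units.  So f = p s p^{-1} is
   injective and, by compactness, T^N (f z) = T^(N+1) z for one N and all z.  Hence the finite fibre
   of T^(N+1) over a point is no larger than the fibre of T^N, onto which T maps it; this makes T
   injective, contradicting U \<noteq> X. *)
theory Submission
  imports Defs
begin

section \<open>Local homeomorphisms: continuity and finite fibres\<close>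

lemma local_homeomorphism_imp_continuous_map:
  assumes "local_homeomorphism X Y f"
  shows "continuous_map X Y f"
  unfolding continuous_map_def
proof (intro conjI allI impI)
  show "f \<in> topspace X \<rightarrow> topspace Y"
    using assms by (simp add: local_homeomorphism_def)
  fix V assume V: "openin Y V"
  show "openin X {x \<in> topspace X. f x \<in> V}"
  proof (subst openin_subopen, intro ballI)
    fix x assume x: "x \<in> {x \<in> topspace X. f x \<in> V}"
    then obtain U where U: "openin X U" "x \<in> U"
      and hm: "homeomorphic_map (subtopology X U) (subtopology Y (f ` U)) f"
      using assms unfolding local_homeomorphism_def by blast
    have "continuous_map (subtopology X U) Y f"
      using homeomorphic_imp_continuous_map[OF hm] by (simp add: continuous_map_in_subtopology)
    then have "openin (subtopology X U) {x \<in> topspace (subtopology X U). f x \<in> V}"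
      using V by (rule openin_continuous_map_preimage)
    then have "openin X {x \<in> topspace (subtopology X U). f x \<in> V}"
      using U(1) by (simp add: openin_open_subtopology)
    moreover have "x \<in> {x \<in> topspace (subtopology X U). f x \<in> V}"
      using x U by auto
    ultimately show "\<exists>W. openin X W \<and> x \<in> W \<and> W \<subseteq> {x \<in> topspace X. f x \<in> V}"
      by (intro exI[of _ "{x \<in> topspace (subtopology X U). f x \<in> V}"]) auto
  qed
qed

text \<open>By compactness, finitely many open sets on which \<open>f\<close> is injective cover the
  space, and each of them meets a given fibre in at most one point.\<close>

lemma local_homeomorphism_finite_fibre:
  assumes f: "local_homeomorphism X Y f" and "compact_space X"
  shows "finite {x \<in> topspace X. f x = y}"
proof -
  define \<U> where "\<U> = {U. openin X U \<and> inj_on f U}"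
  have "topspace X \<subseteq> \<Union>\<U>"
  proof
    fix x assume "x \<in> topspace X"
    then obtain U where U: "openin X U" "x \<in> U"
      and hm: "homeomorphic_map (subtopology X U) (subtopology Y (f ` U)) f"
      using f unfolding local_homeomorphism_def by blast
    have "inj_on f U"
      using homeomorphic_imp_injective_map[OF hm] openin_subset[OF U(1)]
      by (simp add: Int_absorb1)
    then show "x \<in> \<Union>\<U>"
      using U by (auto simp: \<U>_def)
  qed
  moreover have "\<forall>U\<in>\<U>. openin X U"
    by (simp add: \<U>_def)
  ultimately obtain \<F> where \<F>: "finite \<F>" "\<F> \<subseteq> \<U>" "topspace X \<subseteq> \<Union>\<F>"
    using \<open>compact_space X\<close> unfolding compact_space_alt by meson
  have "finite {x \<in> U. f x = y}" if "U \<in> \<F>" for U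
  proof (rule inj_on_finite[of f _ "{y}"])
    show "inj_on f {x \<in> U. f x = y}"
      using that \<F>(2) by (auto simp: \<U>_def inj_on_def)
  qed auto
  then have "finite (\<Union>U\<in>\<F>. {x \<in> U. f x = y})"
    using \<F>(1) by blast
  then show ?thesis
    by (rule finite_subset[rotated]) (use \<F>(3) in blast)
qed

section \<open>Counting points in fibres of iterates\<close>

lemma funpow_finite_fibre:
  assumes "T \<in> S \<rightarrow> S" "\<And>y. finite {x \<in> S. T x = y}"
  shows "finite {x \<in> S. (T ^^ n) x = y}"
proof (induction n)
  case (Suc n)
  \<comment> \<open>Grouping the points by their image under \<open>T\<close> splits the fibre into
    fibres of \<open>T\<close>, indexed by a fibre of the \<open>n\<close>-th iterate.\<close>
  have "{x \<in> S. (T ^^ Suc n) x = y} \<subseteq> (\<Union>z \<in> {z \<in> S. (T ^^ n) z = y}. {x \<in> S. T x = z})"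
    using assms(1) by (auto simp: funpow_swap1)
  then show ?case
    by (rule finite_subset) (use Suc assms(2) in blast)
qed (auto intro: finite_subset[of _ "{y}"])

lemma inj_on_if_funpow_comp_inj:
  assumes surj: "T ` S = S" and fin: "\<And>y. finite {x \<in> S. T x = y}"
    and f: "f \<in> S \<rightarrow> S" "inj_on f S"
    and eq: "\<And>z. z \<in> S \<Longrightarrow> (T ^^ N) (f z) = (T ^^ Suc N) z"
  shows "inj_on T S"
proof (rule inj_onI)
  fix a b assume ab: "a \<in> S" "b \<in> S" "T a = T b"
  \<comment> \<open>All fibres are taken over the same point. It is chosen so that \<open>a\<close>,
    and with it \<open>b\<close>, lies in \<open>F (Suc N)\<close>.\<close>
  define F where "F k = {x \<in> S. (T ^^ k) x = (T ^^ Suc N) a}" for k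
  have finF: "finite (F k)" for k
    unfolding F_def using surj fin by (intro funpow_finite_fibre) auto
  have TF: "T ` F (Suc N) = F N"
  proof
    show "T ` F (Suc N) \<subseteq> F N"
      using surj by (auto simp: F_def funpow_swap1)
    \<comment> \<open>Surjectivity of \<open>T\<close> enters here: every preimage of a point of
      \<open>F N\<close> lies in \<open>F (Suc N)\<close>.\<close>
    show "F N \<subseteq> T ` F (Suc N)"
    proof
      fix z assume z: "z \<in> F N"
      then obtain x where "x \<in> S" "z = T x"
        using surj by (auto simp: F_def)
      then show "z \<in> T ` F (Suc N)"
        using z by (auto simp: F_def funpow_swap1)
    qed
  qed
  have "card (F (Suc N)) \<le> card (F N)"
  proof (rule card_inj_on_le)
    show "inj_on f (F (Suc N))"
      using f(2) by (rule inj_on_subset) (auto simp: F_def)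
    show "f ` F (Suc N) \<subseteq> F N"
      using f(1) eq by (auto simp: F_def)
  qed (rule finF)
  \<comment> \<open>The image \<open>F N\<close> is at least as large as the finite set
    \<open>F (Suc N)\<close>, so \<open>T\<close> identifies no two points of the latter.\<close>
  then have "card (T ` F (Suc N)) = card (F (Suc N))"
    using card_image_le[OF finF, of T "Suc N"] unfolding TF by simp
  then have "inj_on T (F (Suc N))"
    by (rule eq_card_imp_inj_on[OF finF])
  moreover have "a \<in> F (Suc N)" "b \<in> F (Suc N)"
    using ab by (auto simp: F_def funpow_swap1)
  ultimately show "a = b"
    using ab(3) by (auto dest: inj_onD)
qed

section \<open>Continuous families of arrows and the action of automorphisms on arrows\<close>

lemma continuous_map_section_arrow:
  assumes s: "continuous_map X X s"
    and Ts: "\<And>x. x \<in> topspace X \<Longrightarrow> T (s x) = x"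
  shows "continuous_map X (DR_topology X T) (\<lambda>x. (s x, 1, x))"
  unfolding DR_topology_def
proof (rule continuous_on_generated_topo)
  have sX: "s x \<in> topspace X" if "x \<in> topspace X" for x
    using continuous_map_image_subset_topspace[OF s] that by blast
  have arr: "(s x, 1, x) \<in> DR_arrows X T" if "x \<in> topspace X" for x
    unfolding DR_arrows_def mem_Collect_eq
    using that sX Ts by (intro exI[of _ "s x"] exI[of _ 1] exI[of _ 0] exI[of _ x]) auto
  show "(\<lambda>x. (s x, 1, x)) ` topspace X \<subseteq>
      \<Union> {DR_basic X T U n m V |U n m V. openin X U \<and> openin X V}"
    using arr topspace_DR_topology[of X T]
    unfolding DR_topology_def topology_generated_by_topspace by blast
  fix W assume "W \<in> {DR_basic X T U n m V |U n m V. openin X U \<and> openin X V}"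
  then obtain U n m V where W: "W = DR_basic X T U n m V" and UV: "openin X U" "openin X V"
    by blast
  show "openin X ((\<lambda>x. (s x, 1, x)) -` W \<inter> topspace X)"
  \<comment> \<open>A basic set with n - m different from 1 contains no arrow of degree 1. Otherwise
    the equation between iterates follows from \<open>T (s x) = x\<close>, and only the conditions
    on the two endpoints remain.\<close>
  proof (cases "n = Suc m")
    case True
    have "(\<lambda>x. (s x, 1, x)) -` W \<inter> topspace X = {x \<in> topspace X. s x \<in> U} \<inter> V"
      using arr Ts openin_subset[OF UV(2)] unfolding W True DR_basic_def
      by (auto simp: funpow_swap1)
    then show ?thesis
      using openin_continuous_map_preimage[OF s UV(1)] UV(2) by auto
  next
    case False
    then have "(\<lambda>x. (s x, 1, x)) -` W \<inter> topspace X = {}"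
      unfolding W DR_basic_def by auto
    then show ?thesis
      by simp
  qed
qed

lemma DR_arrow_topspace:
  "(y, a, x) \<in> DR_arrows X T \<Longrightarrow> y \<in> topspace X" "(y, a, x) \<in> DR_arrows X T \<Longrightarrow> x \<in> topspace X"
  by (auto simp: DR_arrows_def)

text \<open>An arrow composes with the unit arrows at both of its ends, and \<open>\<Phi>\<close>
  preserves composability. The endpoints of its image are therefore determined by the images of
  these units, while the cocycle condition gives the middle entry.\<close>

lemma DR_automorphism_negating_cocycle:
  assumes \<Phi>: "DR_automorphism X T \<Phi>"
    and neg: "\<And>g. g \<in> DR_arrows X T \<Longrightarrow> DR_cocycle (\<Phi> g) = - DR_cocycle g"
  obtains p where "bij_betw p (topspace X) (topspace X)"
    "\<And>y a x. (y, a, x) \<in> DR_arrows X T \<Longrightarrow> \<Phi> (y, a, x) = (p y, - a, p x)"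
proof -
  define p where "p x = snd (snd (\<Phi> (x, 0, x)))" for x
  have bij: "bij_betw \<Phi> (DR_arrows X T) (DR_arrows X T)"
    and hom: "groupoid_hom (DR_groupoid X T) (DR_groupoid X T) \<Phi>"
    using \<Phi> by (auto simp: DR_automorphism_def groupoid_automorphism_def DR_groupoid_def)
  have comp: "snd (snd (\<Phi> (z, a, y))) = fst (\<Phi> (y, b, x))"
    if "(z, a, y) \<in> DR_arrows X T" "(y, b, x) \<in> DR_arrows X T" for z a y b x
  proof -
    have "composable (DR_groupoid X T) (z, a, y) (y, b, x)"
      using that by (simp add: composable_def DR_groupoid_def)
    then have "composable (DR_groupoid X T) (\<Phi> (z, a, y)) (\<Phi> (y, b, x))"
      using hom unfolding groupoid_hom_def by blast
    then show ?thesis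
      by (simp add: composable_def DR_groupoid_def case_prod_beta)
  qed
  have form: "\<Phi> (y, a, x) = (p y, - a, p x)" if g: "(y, a, x) \<in> DR_arrows X T" for y a x
  proof -
    have u: "(y, 0, y) \<in> DR_arrows X T" "(x, 0, x) \<in> DR_arrows X T"
      using DR_arrow_topspace[OF g] by (auto intro: DR_arrows_unit)
    have "fst (\<Phi> (y, a, x)) = p y"
      using comp[OF u(1) g] by (simp add: p_def)
    moreover have "snd (snd (\<Phi> (y, a, x))) = p x"
      \<comment> \<open>A unit arrow composes with itself, so its image has equal range and source;
        hence \<open>p\<close> may be read off at either end.\<close>
      using comp[OF g u(2)] comp[OF u(2) u(2)] by (simp add: p_def)
    moreover have "fst (snd (\<Phi> (y, a, x))) = - a"
      using neg[OF g] by (simp add: DR_cocycle_def case_prod_beta)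
    ultimately show ?thesis
      by (simp add: prod_eq_iff)
  qed
  have "bij_betw p (topspace X) (topspace X)"
    unfolding bij_betw_def
  proof
    show "inj_on p (topspace X)"
    proof (rule inj_onI)
      fix x y assume xy: "x \<in> topspace X" "y \<in> topspace X" "p x = p y"
      then have u: "(x, 0, x) \<in> DR_arrows X T" "(y, 0, y) \<in> DR_arrows X T"
        by (auto intro: DR_arrows_unit)
      then have "\<Phi> (x, 0, x) = \<Phi> (y, 0, y)"
        using form xy(3) by simp
      then show "x = y"
        using bij u by (auto simp: bij_betw_def dest: inj_onD)
    qed
    show "p ` topspace X = topspace X"
    proof
      show "p ` topspace X \<subseteq> topspace X"
      proof
        fix z assume "z \<in> p ` topspace X"
        then obtain x where x: "x \<in> topspace X" "z = p x"
          by blast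
        have u: "(x, 0, x) \<in> DR_arrows X T"
          using x(1) by (rule DR_arrows_unit)
        then have "\<Phi> (x, 0, x) \<in> DR_arrows X T"
          using bij_betwE[OF bij] by blast
        then show "z \<in> topspace X"
          unfolding form[OF u] x(2) by (rule DR_arrow_topspace(2))
      qed
      show "topspace X \<subseteq> p ` topspace X"
      proof
        fix z assume "z \<in> topspace X"
        then have "(z, 0, z) \<in> \<Phi> ` DR_arrows X T"
          unfolding bij_betw_imp_surj_on[OF bij] by (rule DR_arrows_unit)
        then obtain y a x where g: "(y, a, x) \<in> DR_arrows X T" "\<Phi> (y, a, x) = (z, 0, z)"
          by (metis imageE prod_cases3)
        then have "p x = z"
          using form[OF g(1)] by simp
        then show "z \<in> p ` topspace X"
          using DR_arrow_topspace(2)[OF g(1)] by blast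
      qed
    qed
  qed
  then show ?thesis
    using form that by blast
qed

text \<open>Each arrow of degree -1 satisfies the equation for some exponent. The points where
  exponent \<open>k\<close> works form an open set \<open>W k\<close>, increasing in
  \<open>k\<close>, so compactness provides one exponent for all points.\<close>

lemma DR_arrow_continuous_uniform_lag:
  assumes "compact_space X" "T \<in> topspace X \<rightarrow> topspace X"
    and h: "continuous_map X (DR_topology X T) (\<lambda>x. (r x, - 1, d x))"
  obtains N where "\<And>x. x \<in> topspace X \<Longrightarrow> (T ^^ N) (r x) = (T ^^ Suc N) (d x)"
proof -
  define W where "W k = {x \<in> topspace X. (r x, - 1, d x) \<in>
      DR_basic X T (topspace X) k (Suc k) (topspace X)}" for k
  have arr: "(r x, - 1, d x) \<in> DR_arrows X T" if "x \<in> topspace X" for x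
    using continuous_map_image_subset_topspace[OF h] that unfolding topspace_DR_topology by blast
  have W_iff: "x \<in> W k \<longleftrightarrow> x \<in> topspace X \<and> (T ^^ k) (r x) = (T ^^ Suc k) (d x)" for x k
    unfolding W_def DR_basic_def using arr[of x] by (auto dest: DR_arrow_topspace)
  have "openin (DR_topology X T) (DR_basic X T (topspace X) k (Suc k) (topspace X))" for k
    unfolding DR_topology_def by (rule topology_generated_by_Basis) blast
  then have op: "openin X (W k)" for k
    unfolding W_def using openin_continuous_map_preimage[OF h] by blast
  have cover: "topspace X \<subseteq> \<Union> (range W)"
  proof
    fix x assume x: "x \<in> topspace X"
    then obtain n m where "- 1 = int n - int m" "(T ^^ n) (r x) = (T ^^ m) (d x)"
      using arr[OF x] by (auto simp: DR_arrows_def)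
    moreover from this have "m = Suc n"
      by simp
    ultimately have "x \<in> W n"
      using x W_iff by simp
    then show "x \<in> \<Union> (range W)"
      by blast
  qed
  \<comment> \<open>Applying \<open>T\<close> to both sides of the equation raises the exponent by
    one.\<close>
  have "mono W"
    unfolding mono_iff_le_Suc by (auto simp: W_iff)
  have "\<forall>V\<in>range W. openin X V"
    using op by blast
  then obtain \<F> where \<F>: "finite \<F>" "\<F> \<subseteq> range W" "topspace X \<subseteq> \<Union>\<F>"
    using assms(1) cover unfolding compact_space_alt by meson
  then obtain K where K: "finite K" "\<F> = W ` K"
    by (meson finite_subset_image)
  \<comment> \<open>Inserting 0 keeps \<open>Max\<close> meaningful when the finite subcover is
    empty.\<close>
  have "topspace X \<subseteq> W (Max (insert 0 K))"
  proof
    fix x assume "x \<in> topspace X"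
    then obtain k where "k \<in> K" "x \<in> W k"
      using \<F>(3) K(2) by blast
    moreover from this have "k \<le> Max (insert 0 K)"
      using K(1) by simp
    ultimately show "x \<in> W (Max (insert 0 K))"
      using \<open>mono W\<close> by (auto dest: monoD)
  qed
  then show ?thesis
    using that W_iff by blast
qed

section \<open>Conjugating the section of the map by the automorphism\<close>

theorem proposition5p4p5:
  fixes X :: "'a topology" and T :: "'a \<Rightarrow> 'a"
  assumes "Deaconu_Renault_system X T"
    and "\<exists>U. compactin X U \<and> openin X U \<and> U \<subset> topspace X \<and> T ` U = topspace X \<and> inj_on T U"
  shows "compact_space X \<and> proper_map X X T \<and>
    \<not> (\<exists>\<Phi>. DR_automorphism X T \<Phi> \<and>
          (\<forall>g \<in> DR_arrows X T. DR_cocycle (\<Phi> g) = - DR_cocycle g))"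
proof -
  obtain U where U: "compactin X U" "U \<subset> topspace X" "T ` U = topspace X" "inj_on T U"
    using assms(2) by blast
  have haus: "Hausdorff_space X" and lh: "local_homeomorphism X X T"
    using assms(1) by (auto simp: Deaconu_Renault_system_def)
  have cont: "continuous_map X X T"
    using lh by (rule local_homeomorphism_imp_continuous_map)
  then have TX: "T \<in> topspace X \<rightarrow> topspace X"
    by (simp add: continuous_map_def)
  have cpt: "compact_space X"
    using image_compactin[OF U(1) cont] U(3) by (simp add: compact_space_def)
  have proper: "proper_map X X T"
    using cpt Hausdorff_imp_kc_space[OF haus] cont by (rule continuous_imp_proper_map)
  have False if \<Phi>: "DR_automorphism X T \<Phi>"
    and neg: "\<And>g. g \<in> DR_arrows X T \<Longrightarrow> DR_cocycle (\<Phi> g) = - DR_cocycle g" for \<Phi>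
  proof -
    \<comment> \<open>A continuous bijection from the compact set \<open>U\<close> onto a Hausdorff
      space is a homeomorphism; its inverse is the continuous section \<open>s\<close>.\<close>
    have "homeomorphic_map (subtopology X U) X T"
      using U haus cont
      by (intro continuous_imp_homeomorphic_map)
         (auto simp: compact_space_subtopology continuous_map_from_subtopology Int_absorb1)
    then obtain s where "homeomorphic_maps (subtopology X U) X T s"
      by (auto simp: homeomorphic_map_maps)
    then have s: "continuous_map X X s" and Ts: "\<And>x. x \<in> topspace X \<Longrightarrow> T (s x) = x"
      by (auto simp: homeomorphic_maps_def continuous_map_in_subtopology)
    have sX: "s \<in> topspace X \<rightarrow> topspace X"
      using s by (simp add: continuous_map_def)
    obtain p where p: "bij_betw p (topspace X) (topspace X)"
      and form: "\<And>y a x. (y, a, x) \<in> DR_arrows X T \<Longrightarrow> \<Phi> (y, a, x) = (p y, - a, p x)"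
      using DR_automorphism_negating_cocycle[OF \<Phi> neg] by blast
    have sec: "continuous_map X (DR_topology X T) (\<lambda>x. (s x, 1, x))"
      using s Ts by (rule continuous_map_section_arrow)
    have arr: "(s x, 1, x) \<in> DR_arrows X T" if "x \<in> topspace X" for x
      using continuous_map_image_subset_topspace[OF sec] that
      unfolding topspace_DR_topology by blast
    have "continuous_map (DR_topology X T) (DR_topology X T) \<Phi>"
      using \<Phi> by (auto simp: DR_automorphism_def homeomorphic_imp_continuous_map)
    \<comment> \<open>Continuity of the image arrows is inherited from \<open>\<Phi>\<close> and the
      section as a whole, without treating \<open>p\<close> separately.\<close>
    then have "continuous_map X (DR_topology X T) (\<Phi> \<circ> (\<lambda>x. (s x, 1, x)))"
      by (rule continuous_map_compose[OF sec])
    then have "continuous_map X (DR_topology X T) (\<lambda>x. (p (s x), - 1, p x))"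
      by (rule continuous_map_eq) (simp add: form arr)
    then obtain N where N: "\<And>x. x \<in> topspace X \<Longrightarrow> (T ^^ N) (p (s x)) = (T ^^ Suc N) (p x)"
      using DR_arrow_continuous_uniform_lag[OF cpt TX, of "\<lambda>x. p (s x)" p] by blast
    \<comment> \<open>Substituting \<open>q z\<close> for \<open>x\<close> turns the equation into
      one for the conjugate of \<open>s\<close> by \<open>p\<close>, the form that the counting
      lemma takes.\<close>
    define q where "q = inv_into (topspace X) p"
    have q: "bij_betw q (topspace X) (topspace X)"
      unfolding q_def using p by (rule bij_betw_inv_into)
    have pq: "p (q z) = z" if "z \<in> topspace X" for z
      unfolding q_def using p that by (rule bij_betw_inv_into_right)
    have qX: "q z \<in> topspace X" if "z \<in> topspace X" for z
      using q that by (rule bij_betwE[THEN bspec])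
    have "inj_on T (topspace X)"
    proof (rule inj_on_if_funpow_comp_inj)
      show "T ` topspace X = topspace X"
        using U(2,3) TX by blast
      show "finite {x \<in> topspace X. T x = y}" for y
        using lh cpt by (rule local_homeomorphism_finite_fibre)
      show "(\<lambda>z. p (s (q z))) \<in> topspace X \<rightarrow> topspace X"
        using p sX qX by (auto dest: bij_betwE)
      show "inj_on (\<lambda>z. p (s (q z))) (topspace X)"
      proof (rule inj_onI)
        fix y z assume yz: "y \<in> topspace X" "z \<in> topspace X" "p (s (q y)) = p (s (q z))"
        moreover have "s (q y) \<in> topspace X" "s (q z) \<in> topspace X"
          using sX qX yz(1,2) by auto
        ultimately have "s (q y) = s (q z)"
          using bij_betw_imp_inj_on[OF p] by (meson inj_onD)
        then have "q y = q z"
          using Ts qX yz(1,2) by metis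
        then show "y = z"
          using pq yz(1,2) by metis
      qed
      show "(T ^^ N) (p (s (q z))) = (T ^^ Suc N) z" if "z \<in> topspace X" for z
        using N[OF qX[OF that]] pq[OF that] by simp
    qed
    moreover obtain x where x: "x \<in> topspace X" "x \<notin> U"
      using U(2) by blast
    \<comment> \<open>Since \<open>T\<close> already maps \<open>U\<close> onto the whole space, the
      value at a point outside \<open>U\<close> is also attained inside \<open>U\<close>.\<close>
    moreover have "T x \<in> T ` U"
      using U(3) TX x(1) by blast
    then obtain u where "u \<in> U" "T x = T u"
      by blast
    ultimately show False
      using U(2) by (metis inj_onD psubsetD)
  qed
  then show ?thesis
    using cpt proper by blast
qed

end
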